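(* Let $\ell\ge1$ be an integer. For $0\le m\le n$, the entry $d_{\ell,n}^m$ equals the cardinality of $I_{\ell,n}^m$, the set of $m$-increasing-fixed permutations in $G_{\ell,n}$.
   Context: Write $[n]=\{1,\dots,n\}$ (with $[0]=\emptyset$). For a fixed integer $\ell\ge1$, let $C_\ell$ be the cyclic group generated by $\zeta=e^{2i\pi/\ell}$. The group $G_{\ell,n}=C_\ell\wr S_n$ of colored permutations consists of the pairs $\pi=(\epsilon,\sigma)$ with $\epsilon=(\epsilon_1,\dots,\epsilon_n)\in C_\ell^n$ and $\sigma\in S_n$; $\pi$ is identified with the permutation of the colored set $\{\zeta^j i : i\in[n],\ 0\le j\le \ell-1\}$ (regarded as $C_\ell\times[n]$) given by $\pi(i)=\epsilon_{\sigma(i)}\sigma(i)$ and $\pi(\zeta^j i)=\zeta^j\pi(i)$ for $i\in[n]$. Write $|\pi|=\sigma$ and $\mathrm{sgn}_\pi(i)=\epsilon_i$ for $i\in[n]$ (the color of the letter $i$ in the one-line form of $\pi$). $\mathrm{FIX}(\pi)=\{i\in[n]:\pi(i)=i\}$ is the set of fixed points (the equality requires the letter to be uncolored, i.e. of color $1$). For $0\le m\le n$, $\pi\in G_{\ell,n}$ is called $m$-increasing-fixed if: (i) $\mathrm{sgn}_\pi(|\pi|(i))=1$ for all $i\in[m]$; (ii) $\mathrm{FIX}(\pi)\subseteq[m]$; (iii) $\pi(1)<\pi(2)<\cdots<\pi(m)$ (by (i) these are uncolored integers, compared in the usual order). $I_{\ell,n}^m$ is the set of such permutations. The table $(g_{\ell,n}^m)_{0\le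 m\le n}$ is defined by $g_{\ell,n}^n=\ell^n n!$ and $g_{\ell,n}^m=g_{\ell,n}^{m+1}-g_{\ell,n-1}^m$ for $0\le m\le n-1$, and $d_{\ell,n}^m=g_{\ell,n}^m/(\ell^m m!)$; equivalently $d_{\ell,n}^n=1$ and $d_{\ell,n}^m=\ell(m+1)d_{\ell,n}^{m+1}-d_{\ell,n-1}^m$ for $0\le m\le n-1$. *)

theory Defs
  imports Complex_Main "HOL-Library.FuncSet" "HOL-Combinatorics.Permutations"
begin

definition zeta :: "nat \<Rightarrow> complex" where
  "zeta l = exp (2 * \<i> * of_real pi / of_nat l)"

definition color_group :: "nat \<Rightarrow> complex set" where
  "color_group l = {zeta l ^ j | j. j < l}"

type_synonym colored_perm = "(nat \<Rightarrow> complex) \<times> (nat \<Rightarrow> nat)"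

text \<open>
  A colored permutation is a pair of a color vector and a permutation of \<open>{1..n}\<close>.
  The color vector is extensional (\<open>undefined\<close> outside \<open>{1..n}\<close>) and the permutation is the
  identity outside \<open>{1..n}\<close>, so each element of the wreath product has exactly one
  representative.
\<close>
definition colored_perms :: "nat \<Rightarrow> nat \<Rightarrow> colored_perm set" where
  "colored_perms l n = ({1..n} \<rightarrow>\<^sub>E color_group l) \<times> {\<sigma>. \<sigma> permutes {1..n}}"

definition cp_abs :: "colored_perm \<Rightarrow> nat \<Rightarrow> nat" where
  "cp_abs \<pi> = snd \<pi>"

definition cp_sgn :: "colored_perm \<Rightarrow> nat \<Rightarrow> complex" where
  "cp_sgn \<pi> = fst \<pi>"

text \<open>
  The colored letter \<open>c i\<close> is the pair \<open>(c, i)\<close>; the uncolored letter \<open>i\<close> is \<open>(1, i)\<close>.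
  The color of the image is indexed by the image letter, not by its position.
\<close>
definition cp_apply :: "colored_perm \<Rightarrow> complex \<times> nat \<Rightarrow> complex \<times> nat" where
  "cp_apply \<pi> = (\<lambda>(c, i). (c * cp_sgn \<pi> (cp_abs \<pi> i), cp_abs \<pi> i))"

definition FIX :: "nat \<Rightarrow> colored_perm \<Rightarrow> nat set" where
  "FIX n \<pi> = {i \<in> {1..n}. cp_apply \<pi> (1, i) = (1, i)}"

text \<open>
  The first condition makes the images of \<open>1, \<dots>, m\<close> uncolored, so in the third condition they
  are compared through their letters.
\<close>
definition increasing_fixed :: "nat \<Rightarrow> nat \<Rightarrow> colored_perm \<Rightarrow> bool" where
  "increasing_fixed n m \<pi> \<longleftrightarrow>
     (\<forall>i\<in>{1..m}. cp_sgn \<pi> (cp_abs \<pi> i) = 1) \<and>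
     FIX n \<pi> \<subseteq> {1..m} \<and>
     strict_mono_on {1..m} (\<lambda>i. snd (cp_apply \<pi> (1, i)))"

definition increasing_fixed_perms :: "nat \<Rightarrow> nat \<Rightarrow> nat \<Rightarrow> colored_perm set" where
  "increasing_fixed_perms l n m = {\<pi> \<in> colored_perms l n. increasing_fixed n m \<pi>}"

text \<open>
  The table is integer-valued so that the subtraction is not truncated; only the entries with
  \<open>m \<le> n\<close> are meaningful, the others are set to \<open>0\<close>.
\<close>
function g_table :: "nat \<Rightarrow> nat \<Rightarrow> nat \<Rightarrow> int" where
  "g_table l n m =
     (if m = n then int l ^ n * fact n
      else if m < n then g_table l n (m + 1) - g_table l (n - 1) m
      else 0)"
  by pat_completeness auto
termination
  by (relation "measure (\<lambda>(l, n, m). 2 * n - m)") auto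

declare g_table.simps [simp del]

definition d_table :: "nat \<Rightarrow> nat \<Rightarrow> nat \<Rightarrow> rat" where
  "d_table l n m = of_int (g_table l n m) / (of_nat l ^ m * fact m)"

end

theory Submission
  imports Defs "HOL-Library.Infinite_Set"
begin

text \<open>
  Up to the factor \<open>l ^ m * m!\<close>, an \<open>m\<close>-increasing-fixed permutation is just a colored permutation
  without fixed points outside \<open>{1..m}\<close>. Indeed, recoloring the images of \<open>1, \<dots>, m\<close> or permuting
  them among the first \<open>m\<close> positions does not affect the fixed points outside \<open>{1..m}\<close>; making
  these images uncolored and sorting them picks exactly one representative out of every
  class of \<open>l ^ m * m!\<close> permutations (\<open>card_recolor\<close> and \<open>card_sort\<close>). So it has to be shown that
  \<open>g_table l n m\<close> counts the colored permutations of \<open>{1..n}\<close> without fixed points in \<open>{m+1..n}\<close>.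

  For this count (\<open>card_avoiding\<close>) the right generality is a finite set \<open>S\<close> of letters and an
  arbitrary set \<open>T \<subseteq> S\<close> of forbidden fixed points. The recurrence of the table is then
  the deletion of one forbidden point \<open>t\<close>: the permutations avoiding \<open>T - {t}\<close> either avoid
  \<open>T\<close>, or fix \<open>t\<close> and amount to a colored permutation of \<open>S - {t}\<close> avoiding \<open>T - {t}\<close>. With
  \<open>S\<close> arbitrary, the remaining letters need no relabelling. In the table, such a pair \<open>S\<close>, \<open>T\<close> has the
  indices \<open>n = card S\<close> and \<open>m = card S - card T\<close>. The boundary \<open>T = {}\<close> is the order of the
  wreath product.
\<close>

section \<open>Colored permutations avoiding a set of fixed points\<close>

definition avoiding :: "'c::one set \<Rightarrow> 'a set \<Rightarrow> 'a set \<Rightarrow> (('a \<Rightarrow> 'c) \<times> ('a \<Rightarrow> 'a)) set" where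
  "avoiding C S T =
     {(c, \<sigma>). c \<in> S \<rightarrow>\<^sub>E C \<and> \<sigma> permutes S \<and> (\<forall>i\<in>T. \<not> (\<sigma> i = i \<and> c i = 1))}"

lemma avoiding_empty: "avoiding C S {} = (S \<rightarrow>\<^sub>E C) \<times> {\<sigma>. \<sigma> permutes S}"
  by (auto simp: avoiding_def)

lemma finite_avoiding:
  assumes "finite C" "finite S"
  shows "finite (avoiding C S T)"
proof (rule finite_subset)
  show "avoiding C S T \<subseteq> (S \<rightarrow>\<^sub>E C) \<times> {\<sigma>. \<sigma> permutes S}"
    by (auto simp: avoiding_def)
  show "finite ((S \<rightarrow>\<^sub>E C) \<times> {\<sigma>. \<sigma> permutes S})"
    using assms by (simp add: finite_PiE finite_permutations)
qed

text \<open>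
  A fixed point \<open>t\<close> can be deleted and put back: its color is forced to be \<open>1\<close>.
\<close>
lemma card_avoiding_with_fixed_point:
  fixes C :: "'c::one set"
  assumes "1 \<in> C" "t \<in> S" "t \<notin> T" "T \<subseteq> S"
  shows "card {(c, \<sigma>) \<in> avoiding C S T. \<sigma> t = t \<and> c t = 1} = card (avoiding C (S - {t}) T)"
proof (rule bij_betw_same_card)
  let ?X = "{(c, \<sigma>) \<in> avoiding C S T. \<sigma> t = t \<and> c t = 1}"
  let ?f = "\<lambda>(c, \<sigma>). (restrict c (S - {t}), \<sigma>)"
  let ?g = "\<lambda>(c, \<sigma>). (c(t := 1), \<sigma>)"
  show "bij_betw ?f ?X (avoiding C (S - {t}) T)"
  proof (rule bij_betw_byWitness[where f' = ?g])
    show "\<forall>p\<in>?X. ?g (?f p) = p"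
      by (auto simp: avoiding_def fun_eq_iff restrict_def PiE_def extensional_def)
    show "\<forall>p\<in>avoiding C (S - {t}) T. ?f (?g p) = p"
      by (auto simp: avoiding_def fun_eq_iff restrict_def PiE_def extensional_def)
    have "\<sigma> permutes S - {t}" if "\<sigma> permutes S" "\<sigma> t = t" for \<sigma>
      using that by (auto intro: permutes_superset)
    then show "?f ` ?X \<subseteq> avoiding C (S - {t}) T"
      using assms by (auto simp: avoiding_def PiE_iff split: if_splits)
    have "\<sigma> permutes S" if "\<sigma> permutes S - {t}" for \<sigma>
      using that by (auto intro: permutes_subset)
    then show "?g ` avoiding C (S - {t}) T \<subseteq> ?X"
      using assms by (auto simp: avoiding_def PiE_iff extensional_def permutes_not_in
          split: if_splits)
  qed
qed

lemma card_avoiding: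
  fixes C :: "'c::one set"
  assumes C: "finite C" "1 \<in> C" and S: "finite S" "T \<subseteq> S"
  shows "int (card (avoiding C S T)) = g_table (card C) (card S) (card S - card T)"
proof -
  have "finite T"
    using S finite_subset by blast
  then show ?thesis
    using S
  proof (induction T arbitrary: S)
    case empty
    then show ?case
      by (simp add: avoiding_empty card_cartesian_product card_funcsetE card_permutations
          g_table.simps)
  next
    case (insert t T)
    let ?F = "{(c, \<sigma>) \<in> avoiding C S T. \<sigma> t = t \<and> c t = 1}"
    let ?n = "card S" and ?m = "card S - card (insert t T)"
    have "Suc (card T) \<le> ?n"
      using insert card_mono[of S "insert t T"] by simp
    \<comment> \<open>no truncation: adding \<open>t\<close> to \<open>T\<close>, or removing it from \<open>S\<close>, moves exactly one step in the table\<close>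
    then have m: "?m < ?n" "?n - card T = ?m + 1" "?n - 1 - card T = ?m"
      using insert by auto
    have split: "avoiding C S T = avoiding C S (insert t T) \<union> ?F"
      by (auto simp: avoiding_def)
    have disjoint: "avoiding C S (insert t T) \<inter> ?F = {}"
      by (auto simp: avoiding_def)
    have finite: "finite (avoiding C S (insert t T))" "finite ?F"
      by (rule finite_avoiding[OF C(1) insert.prems(1)])
        (rule finite_subset[OF _ finite_avoiding[OF C(1) insert.prems(1), of T]], auto)
    have "card (avoiding C S T) = card (avoiding C S (insert t T) \<union> ?F)"
      using split by (rule arg_cong)
    also have "\<dots> = card (avoiding C S (insert t T)) + card ?F"
      using finite disjoint by (intro card_Un_disjoint)
    also have "card ?F = card (avoiding C (S - {t}) T)"
      using insert C by (intro card_avoiding_with_fixed_point) auto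
    finally have "int (card (avoiding C S (insert t T)))
        = int (card (avoiding C S T)) - int (card (avoiding C (S - {t}) T))"
      by simp
    also have "int (card (avoiding C S T)) = g_table (card C) ?n (?m + 1)"
      using insert.IH[of S] insert.prems m by simp
    also have "int (card (avoiding C (S - {t}) T)) = g_table (card C) (?n - 1) ?m"
    proof -
      have "T \<subseteq> S - {t}" "card (S - {t}) = ?n - 1"
        using insert by auto
      then show ?thesis
        using insert.IH[of "S - {t}"] insert.prems m by simp
    qed
    also have "g_table (card C) ?n (?m + 1) - g_table (card C) (?n - 1) ?m = g_table (card C) ?n ?m"
      using m(1) by (subst (3) g_table.simps) simp
    finally show ?case .
  qed
qed

section \<open>Removing colors\<close>

definition avoiding_uncolored ::
    "'c::one set \<Rightarrow> 'a set \<Rightarrow> 'a set \<Rightarrow> 'a set \<Rightarrow> (('a \<Rightarrow> 'c) \<times> ('a \<Rightarrow> 'a)) set" where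
  "avoiding_uncolored C S T A = {(c, \<sigma>) \<in> avoiding C S T. \<forall>i\<in>A. c (\<sigma> i) = 1}"

text \<open>
  Colors are indexed by letters, so the colors \<open>e\<close> of the positions in \<open>A\<close> are transported to
  the letters \<open>\<sigma> ` A\<close>. A fixed point in \<open>T\<close> is a letter outside \<open>\<sigma> ` A\<close>, so its color does not change.
\<close>
lemma card_recolor:
  fixes C :: "'c::one set"
  assumes C: "finite C" "1 \<in> C" and S: "finite S" "A \<subseteq> S" "A \<inter> T = {}"
  shows "card (avoiding C S T) = card C ^ card A * card (avoiding_uncolored C S T A)"
proof -
  let ?W = "avoiding_uncolored C S T A \<times> (A \<rightarrow>\<^sub>E C)"
  let ?f = "\<lambda>((c, \<sigma>), e). (\<lambda>x. if x \<in> \<sigma> ` A then e (inv \<sigma> x) else c x, \<sigma>)"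
  let ?g = "\<lambda>(c, \<sigma>). ((\<lambda>x. if x \<in> \<sigma> ` A then 1 else c x, \<sigma>), restrict (c \<circ> \<sigma>) A)"
  have inv: "inv \<sigma> (\<sigma> x) = x" "\<sigma> (inv \<sigma> x) = x" if "\<sigma> permutes S" for \<sigma> and x :: 'a
    using that by (simp_all add: permutes_inverses)
  have inS: "\<sigma> x \<in> S" if "\<sigma> permutes S" "x \<in> A" for \<sigma> x
    using that S by (auto simp: permutes_in_image)
  have fixT: "i \<notin> \<sigma> ` A" if "\<sigma> permutes S" "i \<in> T" "\<sigma> i = i" for \<sigma> i
    using that S inv(1) by (metis disjoint_iff imageE)
  have mem: "\<sigma> x \<in> \<sigma> ` A \<longleftrightarrow> x \<in> A" if "\<sigma> permutes S" for \<sigma> x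
    using permutes_inj[OF that] by (simp add: inj_image_mem_iff)
  have "bij_betw ?f ?W (avoiding C S T)"
  proof (rule bij_betw_byWitness[where f' = ?g])
    show "\<forall>p\<in>?W. ?g (?f p) = p"
      by (auto simp: avoiding_def avoiding_uncolored_def fun_eq_iff inv mem PiE_iff extensional_def)
    show "\<forall>p\<in>avoiding C S T. ?f (?g p) = p"
      by (auto simp: avoiding_def fun_eq_iff inv)
    show "?f ` ?W \<subseteq> avoiding C S T"
      using inS fixT
      by (auto simp: avoiding_def avoiding_uncolored_def PiE_iff extensional_def inv)
    show "?g ` avoiding C S T \<subseteq> ?W"
      using inS fixT C
      by (auto simp: avoiding_def avoiding_uncolored_def PiE_iff extensional_def inv mem)
  qed
  then have "card (avoiding C S T) = card ?W"
    by (rule bij_betw_same_card[symmetric])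
  then show ?thesis
    using finite_subset[OF S(2,1)] by (simp add: card_cartesian_product card_funcsetE)
qed

section \<open>Sorting\<close>

text \<open>
  The least element that is moved down would be mapped to a smaller such element, so the
  permutation moves nothing down.
\<close>
lemma strict_mono_permutes_id:
  fixes \<rho> :: "nat \<Rightarrow> nat"
  assumes "\<rho> permutes A" "finite A" "strict_mono_on A \<rho>"
  shows "\<rho> = id"
proof -
  have "i \<le> \<rho> i" if "i \<in> A" for i
    using that
  proof (induction i rule: less_induct)
    case (less i)
    show ?case
    proof (rule ccontr)
      assume "\<not> i \<le> \<rho> i"
      moreover have "\<rho> i \<in> A"
        using less.prems assms(1) by (simp add: permutes_in_image)
      ultimately have "\<rho> (\<rho> i) < \<rho> i" "\<rho> i \<le> \<rho> (\<rho> i)"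
        using less assms(3) by (auto dest: strict_mono_onD)
      then show False by simp
    qed
  qed
  then show ?thesis
    using assms by (intro permutes_natset_ge) auto
qed

lemma ex1_sorting_permutation:
  fixes f :: "nat \<Rightarrow> nat"
  assumes "finite A" "inj_on f A"
  shows "\<exists>!\<tau>. \<tau> permutes A \<and> strict_mono_on A (f \<circ> \<tau>)"
proof (rule ex_ex1I)
  \<comment> \<open>match the \<open>k\<close>-th position of \<open>A\<close> with the \<open>k\<close>-th smallest value of \<open>f\<close>\<close>
  obtain g where g: "bij_betw g {..<card A} A" "strict_mono_on {..<card A} g"
    using ex_bij_betw_strict_mono_card[OF assms(1)] .
  obtain h where h: "bij_betw h {..<card A} (f ` A)" "strict_mono_on {..<card A} h"
    using ex_bij_betw_strict_mono_card[of "f ` A"] assms by (auto simp: card_image)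
  define \<tau>0 where "\<tau>0 = inv_into A f \<circ> (h \<circ> inv_into {..<card A} g)"
  have ginv: "bij_betw (inv_into {..<card A} g) A {..<card A}"
    using g(1) by (rule bij_betw_inv_into)
  have "bij_betw \<tau>0 A A"
    unfolding \<tau>0_def
    using bij_betw_trans[OF bij_betw_trans[OF ginv h(1)]
        bij_betw_inv_into[OF inj_on_imp_bij_betw[OF assms(2)]]] .
  then have "restrict_id \<tau>0 A permutes A"
    by (rule permutes_restrict_id)
  moreover have "strict_mono_on A (f \<circ> restrict_id \<tau>0 A)"
  proof (rule strict_mono_onI)
    fix x y assume xy: "x \<in> A" "y \<in> A" "x < y"
    let ?i = "inv_into {..<card A} g"
    have i: "?i x \<in> {..<card A}" "?i y \<in> {..<card A}" "g (?i x) = x" "g (?i y) = y"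
      using xy ginv g(1) by (auto dest: bij_betwE simp: bij_betw_inv_into_right)
    then have "?i x < ?i y"
      using strict_mono_on_less[OF g(2)] xy(3) by metis
    then have "h (?i x) < h (?i y)"
      using strict_mono_onD[OF h(2) i(1,2)] by blast
    moreover have "h (?i x) \<in> f ` A" "h (?i y) \<in> f ` A"
      using i h(1) by (auto dest: bij_betwE)
    ultimately show "(f \<circ> restrict_id \<tau>0 A) x < (f \<circ> restrict_id \<tau>0 A) y"
      using xy by (simp add: \<tau>0_def f_inv_into_f)
  qed
  ultimately show "\<exists>\<tau>. \<tau> permutes A \<and> strict_mono_on A (f \<circ> \<tau>)"
    by blast
next
  fix \<tau> \<tau>' assume *: "\<tau> permutes A \<and> strict_mono_on A (f \<circ> \<tau>)"
    "\<tau>' permutes A \<and> strict_mono_on A (f \<circ> \<tau>')"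
  let ?\<rho> = "inv \<tau> \<circ> \<tau>'"
  have \<rho>: "?\<rho> permutes A"
    using * by (intro permutes_compose permutes_inv) auto
  have "strict_mono_on A ?\<rho>"
  proof (rule strict_mono_onI)
    fix x y assume xy: "x \<in> A" "y \<in> A" "x < y"
    have "(f \<circ> \<tau>) (?\<rho> x) < (f \<circ> \<tau>) (?\<rho> y)"
      using * xy strict_mono_onD[of A "f \<circ> \<tau>'" x y] by (simp add: permutes_inverses(1)[of \<tau> A])
    moreover have "?\<rho> x \<in> A" "?\<rho> y \<in> A"
      using xy permutes_in_image[OF \<rho>] by blast+
    ultimately show "?\<rho> x < ?\<rho> y"
      using * strict_mono_on_less by metis
  qed
  with \<rho> have "?\<rho> = id"
    using assms(1) by (intro strict_mono_permutes_id)
  then have "\<tau> \<circ> ?\<rho> = \<tau>"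
    by simp
  then show "\<tau> = \<tau>'"
    using * by (simp add: o_assoc permutes_inv_o(1)[of \<tau> A])
qed

text \<open>
  A pair of a sorted \<open>\<sigma>\<close> and a permutation \<open>\<tau>\<close> of the positions \<open>A\<close> is the same as the permutation
  \<open>\<sigma> \<circ> \<tau>\<close>: the inverse of \<open>\<tau>\<close> is recovered as the only permutation that sorts \<open>\<sigma> \<circ> \<tau>\<close>. Neither the
  set of the letters at \<open>A\<close> nor the letters elsewhere change under composition with \<open>\<tau>\<close>.
\<close>
lemma card_sort:
  fixes C :: "'c::one set" and S :: "nat set"
  assumes S: "finite S" "A \<subseteq> S" "A \<inter> T = {}"
  shows "card (avoiding_uncolored C S T A) =
    fact (card A) * card {(c, \<sigma>) \<in> avoiding_uncolored C S T A. strict_mono_on A \<sigma>}"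
proof -
  let ?I = "{(c, \<sigma>) \<in> avoiding_uncolored C S T A. strict_mono_on A \<sigma>}"
  let ?P = "{\<tau>. \<tau> permutes A}"
  let ?f = "\<lambda>((c, \<sigma>), \<tau>). (c, \<sigma> \<circ> \<tau>)"
  have finA: "finite A"
    using S finite_subset by blast
  have closed: "(c, \<sigma> \<circ> \<tau>) \<in> avoiding_uncolored C S T A"
    if "(c, \<sigma>) \<in> avoiding_uncolored C S T A" "\<tau> permutes A" for c \<sigma> \<tau>
  proof -
    have "\<tau> permutes S"
      using that S by (blast intro: permutes_subset)
    moreover have "\<tau> i = i" if "i \<in> T" for i
      using that \<open>\<tau> permutes A\<close> S by (auto intro: permutes_not_in)
    moreover have "\<tau> i \<in> A" if "i \<in> A" for i
      using that \<open>\<tau> permutes A\<close> by (simp add: permutes_in_image)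
    ultimately show ?thesis
      using that by (auto simp: avoiding_uncolored_def avoiding_def intro: permutes_compose)
  qed
  have inj: "inj_on \<sigma> A" if "(c, \<sigma>) \<in> avoiding_uncolored C S T A" for c and \<sigma> :: "nat \<Rightarrow> nat"
    using that by (auto simp: avoiding_uncolored_def avoiding_def intro: permutes_inj_on)
  have cancel: "(\<sigma> \<circ> \<tau>) \<circ> inv \<tau> = \<sigma>"
    if "\<tau> permutes A" for \<sigma> \<tau> :: "nat \<Rightarrow> nat"
    using that by (auto simp: fun_eq_iff permutes_inverses)
  have "bij_betw ?f (?I \<times> ?P) (avoiding_uncolored C S T A)"
  proof (rule bij_betw_imageI)
    show "inj_on ?f (?I \<times> ?P)"
    proof (rule inj_onI)
      fix p q assume pq: "p \<in> ?I \<times> ?P" "q \<in> ?I \<times> ?P" "?f p = ?f q"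
      obtain c \<sigma> \<tau> c' \<sigma>' \<tau>' where p: "p = ((c, \<sigma>), \<tau>)" and q: "q = ((c', \<sigma>'), \<tau>')"
        by (metis prod.collapse)
      have *: "(c, \<sigma>) \<in> avoiding_uncolored C S T A" "strict_mono_on A \<sigma>" "\<tau> permutes A"
        "strict_mono_on A \<sigma>'" "\<tau>' permutes A"
        and eq: "c = c'" "\<sigma> \<circ> \<tau> = \<sigma>' \<circ> \<tau>'"
        using pq by (auto simp: p q)
      have sorted: "(\<sigma> \<circ> \<tau>) \<circ> inv \<tau> = \<sigma>" "(\<sigma> \<circ> \<tau>) \<circ> inv \<tau>' = \<sigma>'"
        using cancel[OF *(3), of \<sigma>] cancel[OF *(5), of \<sigma>'] eq by simp_all
      then have "strict_mono_on A ((\<sigma> \<circ> \<tau>) \<circ> inv \<tau>)" "strict_mono_on A ((\<sigma> \<circ> \<tau>) \<circ> inv \<tau>')"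
        using *(2,4) by simp_all
      then have "inv \<tau> = inv \<tau>'"
        using ex1_sorting_permutation[OF finA inj[OF closed[OF *(1,3)]]] *(3,5) permutes_inv
        by blast
      moreover from this have "\<tau> = \<tau>'"
        using * by (metis permutes_inv_inv)
      ultimately show "p = q"
        using sorted eq(1) by (simp add: p q)
    qed
    show "?f ` (?I \<times> ?P) = avoiding_uncolored C S T A"
    proof (intro equalityI subsetI)
      fix p assume "p \<in> ?f ` (?I \<times> ?P)"
      then show "p \<in> avoiding_uncolored C S T A"
        using closed by auto
    next
      fix p assume p: "p \<in> avoiding_uncolored C S T A"
      obtain c \<sigma> where cs: "p = (c, \<sigma>)"
        by (cases p)
      obtain \<tau> where \<tau>: "\<tau> permutes A" "strict_mono_on A (\<sigma> \<circ> \<tau>)"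
        using ex1_sorting_permutation[OF finA inj] p cs by blast
      have "((c, \<sigma> \<circ> \<tau>), inv \<tau>) \<in> ?I \<times> ?P"
        using closed \<tau> p cs by (auto intro: permutes_inv)
      moreover have "p = ?f ((c, \<sigma> \<circ> \<tau>), inv \<tau>)"
        using cs cancel[OF \<tau>(1)] by simp
      ultimately show "p \<in> ?f ` (?I \<times> ?P)"
        by (rule rev_image_eqI)
    qed
  qed
  then have "card (avoiding_uncolored C S T A) = card (?I \<times> ?P)"
    by (rule bij_betw_same_card[symmetric])
  then show ?thesis
    using finA by (simp add: card_cartesian_product card_permutations)
qed

section \<open>Increasing-fixed permutations\<close>

lemma color_group_eq_roots_unity:
  assumes "l \<ge> 1"
  shows "color_group l = {z. z ^ l = 1}" and "card (color_group l) = l"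
proof -
  have "zeta l ^ j = cis (2 * pi * real j / real l)" for j
  proof -
    have "zeta l = cis (2 * pi / real l)"
      by (simp add: zeta_def cis_conv_exp mult_ac)
    then show ?thesis
      by (simp add: DeMoivre mult_ac)
  qed
  then have "color_group l = (\<lambda>k. cis (2 * pi * real k / real l)) ` {..<l}"
    by (auto simp: color_group_def)
  then show "color_group l = {z. z ^ l = 1}"
    using bij_betw_roots_unity[of l] assms by (simp add: bij_betw_def)
  then show "card (color_group l) = l"
    using bij_betw_same_card[OF bij_betw_roots_unity[of l]] assms by simp
qed

lemma increasing_fixed_perms_eq:
  "increasing_fixed_perms l n m =
    {(c, \<sigma>) \<in> avoiding_uncolored (color_group l) {1..n} ({1..n} - {1..m}) {1..m}.
      strict_mono_on {1..m} \<sigma>}"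
proof -
  have "FIX n (c, \<sigma>) = {i \<in> {1..n}. \<sigma> i = i \<and> c i = 1}" for c \<sigma>
    by (auto simp: FIX_def cp_apply_def cp_abs_def cp_sgn_def)
  then have "FIX n (c, \<sigma>) \<subseteq> {1..m} \<longleftrightarrow> (\<forall>i\<in>{1..n} - {1..m}. \<not> (\<sigma> i = i \<and> c i = 1))" for c \<sigma>
    by blast
  then have "increasing_fixed n m (c, \<sigma>) \<longleftrightarrow>
      (\<forall>i\<in>{1..m}. c (\<sigma> i) = 1) \<and> (\<forall>i\<in>{1..n} - {1..m}. \<not> (\<sigma> i = i \<and> c i = 1)) \<and>
      strict_mono_on {1..m} \<sigma>" for c \<sigma>
    by (simp add: increasing_fixed_def cp_apply_def cp_abs_def cp_sgn_def)
  then show ?thesis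
    unfolding increasing_fixed_perms_def colored_perms_def avoiding_uncolored_def avoiding_def
    by auto
qed

theorem theorem10:
  fixes l n m :: nat
  assumes "l \<ge> 1" and "m \<le> n"
  shows "d_table l n m = of_nat (card (increasing_fixed_perms l n m))"
proof -
  let ?C = "color_group l" and ?S = "{1..n}" and ?A = "{1..m}"
  have C: "finite ?C" "1 \<in> ?C" "card ?C = l"
    using color_group_eq_roots_unity[OF assms(1)] assms(1)
    by (auto intro: card_ge_0_finite)
  have T: "card (?S - ?A) = n - m"
    using assms by (subst card_Diff_subset) auto
  have "g_table l n m = int (card (avoiding ?C ?S (?S - ?A)))"
    using card_avoiding[OF C(1,2), of ?S "?S - ?A"] C(3) T assms by simp
  also have "card (avoiding ?C ?S (?S - ?A)) =
      l ^ m * card (avoiding_uncolored ?C ?S (?S - ?A) ?A)"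
    using card_recolor[OF C(1,2), of ?S ?A "?S - ?A"] C(3) assms by simp
  also have "card (avoiding_uncolored ?C ?S (?S - ?A) ?A) =
      fact m * card (increasing_fixed_perms l n m)"
    using card_sort[of ?S ?A "?S - ?A" ?C] assms by (simp add: increasing_fixed_perms_eq)
  finally show ?thesis
    using assms(1) by (simp add: d_table_def)
qed

end
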